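(* Let $H$ be a real Hilbert space, let $T_1:H\rightrightarrows H$ be maximal monotone and $T_2:H\to H$ be $\delta$-cocoercive for some $\delta>0$. Let $\gamma\in(0,2\delta]$. Given $(\beta_n)_{n\in\mathbb{N}}\subset(0,1]$, $(\lambda_n)_{n\in\mathbb{N}}\subset\big(0,\frac{4\delta-\gamma}{2\delta}\big]$ and $x_0\in H$, let $(x_n)$ be generated by $$x_{n+1}=(1-\lambda_n)\beta_n x_n+\lambda_n J_{\gamma T_1}\big(\beta_n x_n-\gamma T_2(\beta_n x_n)\big)\qquad(n\in\mathbb{N}).$$ Assume that there exist $\ell\in\mathbb{N}\setminus\{0\}$ and monotone functions $b,D,B,L:\mathbb{N}\to\mathbb{N}$ and $h:\mathbb{N}\to\mathbb{N}\setminus\{0\}$ such that 1. $\forall n\in\mathbb{N}\ \big(\beta_n\ge \frac{1}{h(n)}\big)$; 2. $\forall k\in\mathbb{N}\ \forall n\ge b(k)\ \big(|1-\beta_n|\le\frac{1}{k+1}\big)$; 3. $\forall k\in\mathbb{N}\ \big(\sum_{i=1}^{D(k)}(1-\beta_i)\ge k\big)$; 4. $\forall k\in\mathbb{N}\ \forall n\in\mathbb{N}\ \big(\sum_{i=B(k)+1}^{B(k)+n}|\beta_i-\beta_{i-1}|\le\frac{1}{k+1}\big)$; 5. $\forall n\in\mathbb{N}\ \big(\lambda_n\ge\frac1\ell\big)$; 6. $\forall k\in\mathbb{N}\ \forall n\in\mathbb{N}\ \big(\sum_{i=L(k)+1}^{L(k)+n}|\lambda_i-\lambda_{i-1}|\le\frac{1}{k+1}\big)$.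 Assume that there exists $N\in\mathbb{N}\setminus\{0\}$ such that $N\ge\max\{\|x_0-p\|,\|p\|\}$ for some $p\in \mathrm{zer}(T_1+T_2)$. Then for all $k\in\mathbb{N}$ and all monotone functions $f:\mathbb{N}\to\mathbb{N}$, $$\exists n\le\mu_2(k,f)\ \forall i,j\in[n,f(n)]\ \Big(\|x_i-x_j\|\le\frac{1}{k+1}\Big),$$ where $\mu_2(k,f):=\mu[N,2\ell,b,h,D,B,L](k,f)$, with $\mu$ the explicit functional defined in the context.
   Context: $\mathbb{N}=\{0,1,2,\dots\}$. A function $f:\mathbb{N}\to\mathbb{N}$ is called monotone if it is nondecreasing. $[a,c]$ denotes the integer interval (empty if $c<a$). For a function $g:\mathbb{N}\to\mathbb{N}$, $g^{(R)}$ denotes its $R$-fold iterate. For a maximal monotone operator $\mathsf A:H\rightrightarrows H$ and $\gamma>0$, the resolvent is the single-valued map $J_{\gamma\mathsf A}=(\mathrm{Id}+\gamma\mathsf A)^{-1}:H\to H$. $\mathrm{zer}(\mathsf A)$ is the set of zeros of $\mathsf A$. A map $\mathsf B:H\to H$ is $\delta$-cocoercive if $\langle x-y,\mathsf B(x)-\mathsf B(y)\rangle\ge\delta\|\mathsf B(x)-\mathsf B(y)\|^2$ for all $x,y\in H$. Definition of $\mu[N,\ell,b,h,D,B,L]$, for arbitrary $N,\ell\in\mathbb{N}\setminus\{0\}$ and monotone functions $b,D,B,L:\mathbb{N}\to\mathbb{N}$, $h:\mathbb{N}\to\mathbb{N}\setminus\{0\}$ (in the claim it is used with $2\ell$ in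 place of $\ell$): - $G(k):=\max\{B(4N(k+1)-1),\,L(10N(k+1)-1)\}$. - $\nu_1(k):=D\big(M-1+\lceil\ln(6N(k+1))\rceil\big)+1$, where $M:=\max\{0,\,G(3k+2)+1\}$. - $\nu_2(k):=\max\{b(4N\ell(k+1)-1),\,\nu_1(2\ell(k+1)-1)\}$. - For $k\in\mathbb{N}$ and monotone $f:\mathbb{N}\to\mathbb{N}$: $\psi(k,f):=\nu_2\big(48N(\check g^{(R)}(0)+1)^2\big)$, where $g(m):=f(\nu_2(m))$, $R:=64N^4(k+1)^2$ and $\check g(m):=\max\{g(48N(m+1)^2),\,48N(m+1)^2\}$. - $\sigma(k,n):=D\big(n+\lceil\ln(27N^2(k+1))\rceil\big)+1$. - Given $k$ and $f$: $\widetilde k:=4(k+1)^2-1$, $n_1:=b(54N^2(\widetilde k+1)-1)$, $\overline f(m):=f\big(\sigma(\widetilde k,\max\{m,n_1\})\big)$, $\widetilde f(m):=3(10N+1)(\widetilde k+1)(\overline f(m)+1)\,h(\overline f(m))-1$. - $\mu(k,f):=\sigma\big(\widetilde k,\max\{\psi(12(\widetilde k+1)-1,\widetilde f),\,n_1\}\big)$. *)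

theory Defs
  imports "HOL-Analysis.Analysis"
begin

section \<open>Set-valued operators on a real Hilbert space\<close>

definition monotone_op :: "('a::real_inner \<Rightarrow> 'a set) \<Rightarrow> bool" where
  "monotone_op A \<longleftrightarrow> (\<forall>x y. \<forall>u\<in>A x. \<forall>v\<in>A y. (x - y) \<bullet> (u - v) \<ge> 0)"

text \<open>The order on \<open>'a \<Rightarrow> 'a set\<close> is pointwise inclusion, i.e. inclusion of graphs.\<close>

definition maximal_monotone_op :: "('a::real_inner \<Rightarrow> 'a set) \<Rightarrow> bool" where
  "maximal_monotone_op A \<longleftrightarrow>
     monotone_op A \<and> (\<forall>A'. monotone_op A' \<and> A \<le> A' \<longrightarrow> A' = A)"

definition op_sum :: "('a::real_inner \<Rightarrow> 'a set) \<Rightarrow> ('a \<Rightarrow> 'a set) \<Rightarrow> 'a \<Rightarrow> 'a set" where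
  "op_sum A A' x = {u + v | u v. u \<in> A x \<and> v \<in> A' x}"

definition zer :: "('a::real_inner \<Rightarrow> 'a set) \<Rightarrow> 'a set" where
  "zer A = {x. 0 \<in> A x}"

text \<open>The description operator is justified for maximal monotone \<open>A\<close> and \<open>c > 0\<close> on a
  complete space: \<open>(Id + c A)\<inverse>\<close> is then everywhere defined and single-valued.\<close>

definition resolvent :: "real \<Rightarrow> ('a::real_inner \<Rightarrow> 'a set) \<Rightarrow> 'a \<Rightarrow> 'a" where
  "resolvent c A x = (THE y. x \<in> {y + c *\<^sub>R u | u. u \<in> A y})"

definition cocoercive :: "real \<Rightarrow> ('a::real_inner \<Rightarrow> 'a) \<Rightarrow> bool" where
  "cocoercive d T \<longleftrightarrow> (\<forall>x y. (x - y) \<bullet> (T x - T y) \<ge> d * (norm (T x - T y))\<^sup>2)"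

section \<open>The rate of metastability\<close>

text \<open>All subtractions below are on \<open>nat\<close>; none of them truncates when \<open>N\<close>, \<open>l\<close> and all
  values of \<open>h\<close> are positive.  Likewise the arguments of \<open>ln\<close> are then at least \<open>1\<close>, so that
  \<open>nat\<close> does not truncate the ceilings.\<close>

definition rate_G :: "nat \<Rightarrow> (nat \<Rightarrow> nat) \<Rightarrow> (nat \<Rightarrow> nat) \<Rightarrow> nat \<Rightarrow> nat" where
  "rate_G N B L k = max (B (4 * N * (k + 1) - 1)) (L (10 * N * (k + 1) - 1))"

definition rate_nu1 ::
  "nat \<Rightarrow> (nat \<Rightarrow> nat) \<Rightarrow> (nat \<Rightarrow> nat) \<Rightarrow> (nat \<Rightarrow> nat) \<Rightarrow> nat \<Rightarrow> nat" where
  "rate_nu1 N D B L k =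
     (let M = max 0 (rate_G N B L (3 * k + 2) + 1)
      in D (M - 1 + nat \<lceil>ln (real (6 * N * (k + 1)))\<rceil>) + 1)"

definition rate_nu2 ::
  "nat \<Rightarrow> nat \<Rightarrow> (nat \<Rightarrow> nat) \<Rightarrow> (nat \<Rightarrow> nat) \<Rightarrow> (nat \<Rightarrow> nat) \<Rightarrow> (nat \<Rightarrow> nat) \<Rightarrow> nat \<Rightarrow> nat" where
  "rate_nu2 N l b D B L k =
     max (b (4 * N * l * (k + 1) - 1)) (rate_nu1 N D B L (2 * l * (k + 1) - 1))"

definition rate_psi ::
  "nat \<Rightarrow> nat \<Rightarrow> (nat \<Rightarrow> nat) \<Rightarrow> (nat \<Rightarrow> nat) \<Rightarrow> (nat \<Rightarrow> nat) \<Rightarrow> (nat \<Rightarrow> nat)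
    \<Rightarrow> nat \<Rightarrow> (nat \<Rightarrow> nat) \<Rightarrow> nat" where
  "rate_psi N l b D B L k f =
     (let g = (\<lambda>m. f (rate_nu2 N l b D B L m));
          R = 64 * N ^ 4 * (k + 1)\<^sup>2;
          gc = (\<lambda>m. max (g (48 * N * (m + 1)\<^sup>2)) (48 * N * (m + 1)\<^sup>2))
      in rate_nu2 N l b D B L (48 * N * ((gc ^^ R) 0 + 1)\<^sup>2))"

definition rate_sigma :: "nat \<Rightarrow> (nat \<Rightarrow> nat) \<Rightarrow> nat \<Rightarrow> nat \<Rightarrow> nat" where
  "rate_sigma N D k n = D (n + nat \<lceil>ln (real (27 * N\<^sup>2 * (k + 1)))\<rceil>) + 1"

definition rate_mu ::
  "nat \<Rightarrow> nat \<Rightarrow> (nat \<Rightarrow> nat) \<Rightarrow> (nat \<Rightarrow> nat) \<Rightarrow> (nat \<Rightarrow> nat) \<Rightarrow> (nat \<Rightarrow> nat) \<Rightarrow> (nat \<Rightarrow> nat)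
    \<Rightarrow> nat \<Rightarrow> (nat \<Rightarrow> nat) \<Rightarrow> nat" where
  "rate_mu N l b h D B L k f =
     (let kt = 4 * (k + 1)\<^sup>2 - 1;
          n1 = b (54 * N\<^sup>2 * (kt + 1) - 1);
          fb = (\<lambda>m. f (rate_sigma N D kt (max m n1)));
          ft = (\<lambda>m. 3 * (10 * N + 1) * (kt + 1) * (fb m + 1) * h (fb m) - 1)
      in rate_sigma N D kt (max (rate_psi N l b D B L (12 * (kt + 1) - 1) ft) n1))"

end

theory Submission
  imports Defs
begin

text \<open>With \<open>\<alpha> = 2\<delta> / (4\<delta> - \<gamma>)\<close>, the forward-backward operator is \<open>(1 - \<alpha>) Id + \<alpha> T\<close> with \<open>T\<close>
  nonexpansive (Minty's theorem makes it everywhere defined), so the iteration is a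
  Krasnoselskii-Mann iteration of \<open>T\<close> at \<open>y n = \<beta> n x n\<close> with relaxation \<open>\<alpha> lam n\<close>, which is at
  least \<open>1 / (2 l)\<close> since \<open>\<alpha> \<ge> 1 / 2\<close>.  The \<open>y n\<close> are approximate fixed points.  A point \<open>w\<close> that is
  simultaneously an approximate fixed point and an approximate projection of \<open>0\<close> onto the
  approximate fixed points satisfies
  \<open>\<parallel>x (n + 1) - w\<parallel>\<^sup>2 \<le> \<beta> n \<parallel>x n - w\<parallel>\<^sup>2 + 2 (1 - \<beta> n) (w \<bullet> (w - y n)) + error\<close>, and the contraction by
  the products of the \<open>\<beta> n\<close> makes all \<open>x n\<close> of the required interval close to \<open>w\<close>.\<close>

section \<open>Minty's theorem and the forward-backward operator\<close>

text \<open>Letting \<open>t\<close> tend to 0 from the right turns minimality along a segment into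
  a first-order condition.\<close>

lemma nonneg_if_nonneg_affine_near_0:
  fixes c d :: real
  assumes "\<And>t. 0 < t \<Longrightarrow> t < 1 \<Longrightarrow> 0 \<le> c + t * d"
  shows "0 \<le> c"
proof -
  have "((\<lambda>t. c + t * d) \<longlongrightarrow> c + 0 * d) (at_right 0)"
    by (intro tendsto_intros)
  moreover have "\<forall>\<^sub>F t in at_right 0. 0 \<le> c + t * d"
    using eventually_at_right_less[of "0::real"] eventually_at_right[of 0 "1::real"] assms
    by (metis (mono_tags, lifting) zero_less_one)
  ultimately have "0 \<le> c + 0 * d"
    by (intro tendsto_lowerbound[of _ _ "at_right 0"]) auto
  then show ?thesis by simp
qed

text \<open>Minimise the strongly convex function \<open>F x u + \<parallel>x\<parallel>\<^sup>2 / 2 + \<parallel>u\<parallel>\<^sup>2 / 2\<close>, where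
  \<open>F x u\<close> is the supremum of \<open>x \<bullet> \<alpha> + a \<bullet> u - a \<bullet> \<alpha>\<close> over \<open>(a, \<alpha>) \<in> G\<close> (the Fitzpatrick
  function of \<open>G\<close>).  The predicate \<open>E\<close> is the epigraph of \<open>F\<close>, which avoids infinite values.\<close>

lemma maximal_monotone_graph_meets_antidiagonal:
  fixes G :: "('a::{real_inner, complete_space} \<times> 'a) set"
  assumes mono: "\<And>a \<alpha> b \<beta>. (a, \<alpha>) \<in> G \<Longrightarrow> (b, \<beta>) \<in> G \<Longrightarrow> (a - b) \<bullet> (\<alpha> - \<beta>) \<ge> 0"
    and max: "\<And>x u. (\<And>a \<alpha>. (a, \<alpha>) \<in> G \<Longrightarrow> (x - a) \<bullet> (u - \<alpha>) \<ge> 0) \<Longrightarrow> (x, u) \<in> G"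
  shows "\<exists>x. (x, - x) \<in> G"
proof -
  define E where "E x u r \<longleftrightarrow> (\<forall>(a, \<alpha>) \<in> G. x \<bullet> \<alpha> + a \<bullet> u - a \<bullet> \<alpha> \<le> r)" for x u r
  define \<phi> where "\<phi> x u r = r + (x \<bullet> x) / 2 + (u \<bullet> u) / 2" for x u :: 'a and r
  \<comment> \<open>If \<open>r < x \<bullet> u\<close>, then \<open>(x, u)\<close> is monotonically
    related to all of \<open>G\<close>, so \<open>max\<close> puts it into \<open>G\<close>; testing
    \<open>E x u r\<close> at \<open>(x, u)\<close> itself gives a contradiction.\<close>
  have E_ge: "x \<bullet> u \<le> r" if "E x u r" for x u r
  proof (rule ccontr)
    assume r: "\<not> x \<bullet> u \<le> r"
    have "(x, u) \<in> G"
    proof (rule max)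
      fix a \<alpha> assume "(a, \<alpha>) \<in> G"
      with that have "x \<bullet> \<alpha> + a \<bullet> u - a \<bullet> \<alpha> \<le> r" by (auto simp: E_def)
      with r show "(x - a) \<bullet> (u - \<alpha>) \<ge> 0" by (simp add: inner_diff_left inner_diff_right)
    qed
    with that r show False by (auto simp: E_def)
  qed
  have E_graph: "E a \<alpha> (a \<bullet> \<alpha>)" if "(a, \<alpha>) \<in> G" for a \<alpha>
    unfolding E_def using mono[OF that]
    by (auto simp: inner_diff_left inner_diff_right algebra_simps)
  have E_convex: "E ((1 - t) *\<^sub>R x + t *\<^sub>R y) ((1 - t) *\<^sub>R u + t *\<^sub>R v) ((1 - t) * r + t * s)"
    if "E x u r" "E y v s" "0 \<le> t" "t \<le> 1" for x y u v r s t
    unfolding E_def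
  proof clarify
    fix a \<alpha> assume "(a, \<alpha>) \<in> G"
    with that(1,2) have "x \<bullet> \<alpha> + a \<bullet> u - a \<bullet> \<alpha> \<le> r" "y \<bullet> \<alpha> + a \<bullet> v - a \<bullet> \<alpha> \<le> s"
      by (auto simp: E_def)
    then have "(1 - t) * (x \<bullet> \<alpha> + a \<bullet> u - a \<bullet> \<alpha>) + t * (y \<bullet> \<alpha> + a \<bullet> v - a \<bullet> \<alpha>)
        \<le> (1 - t) * r + t * s"
      using that(3,4) by (intro add_mono mult_left_mono) auto
    then show "((1 - t) *\<^sub>R x + t *\<^sub>R y) \<bullet> \<alpha> + a \<bullet> ((1 - t) *\<^sub>R u + t *\<^sub>R v) - a \<bullet> \<alpha>
        \<le> (1 - t) * r + t * s"
      by (simp add: inner_add_left inner_add_right algebra_simps)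
  qed
  have \<phi>_nonneg: "0 \<le> \<phi> x u r" if "E x u r" for x u r
  proof -
    have "0 \<le> (x + u) \<bullet> (x + u)" by simp
    with E_ge[OF that] show ?thesis
      by (simp add: \<phi>_def inner_add_left inner_add_right inner_commute)
  qed
  define S where "S = {\<phi> x u r | x u r. E x u r}"
  have bdd: "bdd_below S" using \<phi>_nonneg by (auto simp: S_def intro!: bdd_belowI[of _ 0])
  \<comment> \<open>For empty \<open>G\<close> the premise of \<open>max\<close> would be
    vacuous.\<close>
  obtain a0 \<alpha>0 where a0: "(a0, \<alpha>0) \<in> G" using max by blast
  then have "S \<noteq> {}" using E_graph unfolding S_def by blast
  define m where "m = Inf S"
  have m_le: "m \<le> \<phi> x u r" if "E x u r" for x u r
    unfolding m_def using that bdd by (intro cInf_lower) (auto simp: S_def)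
  have "\<exists>x u r. E x u r \<and> \<phi> x u r < m + inverse (real (Suc n))" for n
    using cInf_lessD[OF \<open>S \<noteq> {}\<close>, of "m + inverse (real (Suc n))"]
    by (auto simp: S_def m_def)
  then obtain X U R where E_seq: "\<And>n. E (X n) (U n) (R n)"
    and \<phi>_seq: "\<And>n. \<phi> (X n) (U n) (R n) < m + inverse (real (Suc n))"
    by metis
  \<comment> \<open>Strong convexity: the value of \<open>\<phi>\<close> at the midpoint is at least
    \<open>m\<close>, which forces two near-minimisers to be close.\<close>
  have dist_sq: "(norm (X i - X j))\<^sup>2 + (norm (U i - U j))\<^sup>2
      \<le> 4 * (inverse (real (Suc i)) + inverse (real (Suc j)))" for i j
  proof -
    have "m \<le> \<phi> ((1 - 1/2) *\<^sub>R X i + (1/2) *\<^sub>R X j) ((1 - 1/2) *\<^sub>R U i + (1/2) *\<^sub>R U j)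
        ((1 - 1/2) * R i + (1/2) * R j)"
      by (intro m_le E_convex E_seq) auto
    also have "\<dots> = (\<phi> (X i) (U i) (R i) + \<phi> (X j) (U j) (R j)) / 2
        - ((norm (X i - X j))\<^sup>2 + (norm (U i - U j))\<^sup>2) / 8"
      unfolding power2_norm_eq_inner \<phi>_def
      by (simp add: inner_add_left inner_add_right inner_diff_left inner_diff_right
          inner_commute field_simps)
    finally have mid: "m \<le> (\<phi> (X i) (U i) (R i) + \<phi> (X j) (U j) (R j)) / 2
        - ((norm (X i - X j))\<^sup>2 + (norm (U i - U j))\<^sup>2) / 8" .
    have "d \<le> 4 * (a + b)" if "m \<le> (P + Q) / 2 - d / 8" "P < m + a" "Q < m + b"
      for P Q d a b :: real
      using that by argo
    from this[OF mid \<phi>_seq \<phi>_seq] show ?thesis .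
  qed
  have Cauchy_if: "Cauchy Z"
    if Z: "\<And>i j. (norm (Z i - Z j))\<^sup>2 \<le> 4 * (inverse (real (Suc i)) + inverse (real (Suc j)))"
    for Z :: "nat \<Rightarrow> 'a"
  proof (rule CauchyI)
    fix e :: real assume "0 < e"
    then obtain M where M: "inverse (real (Suc M)) < e\<^sup>2 / 8"
      using reals_Archimedean[of "e\<^sup>2 / 8"] by auto
    show "\<exists>M. \<forall>m\<ge>M. \<forall>n\<ge>M. norm (Z m - Z n) < e"
    proof (intro exI allI impI)
      fix i j assume "M \<le> i" "M \<le> j"
      then have "inverse (real (Suc i)) \<le> inverse (real (Suc M))"
        "inverse (real (Suc j)) \<le> inverse (real (Suc M))"
        by (auto intro!: le_imp_inverse_le)
      with M Z[of i j] have "(norm (Z i - Z j))\<^sup>2 < e\<^sup>2" by argo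
      then show "norm (Z i - Z j) < e" using \<open>0 < e\<close> by (simp add: power2_less_imp_less)
    qed
  qed
  have "Cauchy X" "Cauchy U"
    by (rule Cauchy_if, smt (verit) dist_sq zero_le_power2)+
  then obtain x u where lim: "X \<longlonglongrightarrow> x" "U \<longlonglongrightarrow> u"
    using Cauchy_convergent_iff convergent_def by blast
  have "(\<lambda>n. m + inverse (real (Suc n))) \<longlonglongrightarrow> m + 0"
    by (intro tendsto_intros LIMSEQ_inverse_real_of_nat)
  then have upper: "(\<lambda>n. m + inverse (real (Suc n))) \<longlonglongrightarrow> m" by (simp only: add_0_right)
  \<comment> \<open>\<open>R\<close> has no Cauchy estimate of its own; it converges because
    \<open>\<phi>\<close> and the two quadratic terms do.\<close>
  have "(\<lambda>n. \<phi> (X n) (U n) (R n)) \<longlonglongrightarrow> m"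
    by (rule tendsto_sandwich[OF _ _ tendsto_const upper])
      (intro always_eventually allI m_le E_seq less_imp_le[OF \<phi>_seq])+
  then have "(\<lambda>n. \<phi> (X n) (U n) (R n) - (X n \<bullet> X n) / 2 - (U n \<bullet> U n) / 2)
      \<longlonglongrightarrow> m - (x \<bullet> x) / 2 - (u \<bullet> u) / 2"
    using lim by (intro tendsto_intros) auto
  moreover define r where "r = m - (x \<bullet> x) / 2 - (u \<bullet> u) / 2"
  ultimately have lim_R: "R \<longlonglongrightarrow> r" by (simp add: \<phi>_def)
  have E_min: "E x u r"
    unfolding E_def
  proof clarify
    fix a \<alpha> assume "(a, \<alpha>) \<in> G"
    then have "X n \<bullet> \<alpha> + a \<bullet> U n - a \<bullet> \<alpha> \<le> R n" for n using E_seq[of n] by (auto simp: E_def)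
    moreover have "(\<lambda>n. X n \<bullet> \<alpha> + a \<bullet> U n - a \<bullet> \<alpha>) \<longlonglongrightarrow> x \<bullet> \<alpha> + a \<bullet> u - a \<bullet> \<alpha>"
      using lim by (intro tendsto_intros)
    ultimately show "x \<bullet> \<alpha> + a \<bullet> u - a \<bullet> \<alpha> \<le> r" using lim_R LIMSEQ_le by blast
  qed
  \<comment> \<open>First-order condition at the minimiser in the direction of a graph point,
    combined with \<open>x \<bullet> u \<le> r\<close>.\<close>
  have optimal: "(x + u) \<bullet> (x + u) \<le> (a + u) \<bullet> (\<alpha> + x)" if "(a, \<alpha>) \<in> G" for a \<alpha>
  proof -
    have "0 \<le> (a \<bullet> \<alpha> - r + x \<bullet> (a - x) + u \<bullet> (\<alpha> - u))
        + t * (((a - x) \<bullet> (a - x) + (\<alpha> - u) \<bullet> (\<alpha> - u)) / 2)" if t: "0 < t" "t < 1" for t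
    proof -
      have "m \<le> \<phi> ((1 - t) *\<^sub>R x + t *\<^sub>R a) ((1 - t) *\<^sub>R u + t *\<^sub>R \<alpha>) ((1 - t) * r + t * (a \<bullet> \<alpha>))"
        using t E_graph[OF \<open>(a, \<alpha>) \<in> G\<close>] by (intro m_le E_convex E_min) auto
      then have "0 \<le> t * ((a \<bullet> \<alpha> - r + x \<bullet> (a - x) + u \<bullet> (\<alpha> - u))
        + t * (((a - x) \<bullet> (a - x) + (\<alpha> - u) \<bullet> (\<alpha> - u)) / 2))"
        unfolding \<phi>_def r_def
        by (simp add: inner_add_left inner_add_right inner_diff_left inner_diff_right
            inner_commute field_simps power2_eq_square)
      then show ?thesis using t by (simp add: zero_le_mult_iff)
    qed
    then have "0 \<le> a \<bullet> \<alpha> - r + x \<bullet> (a - x) + u \<bullet> (\<alpha> - u)"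
      by (rule nonneg_if_nonneg_affine_near_0)
    with E_ge[OF E_min] show ?thesis
      by (simp add: inner_add_left inner_add_right inner_diff_left inner_diff_right
          inner_commute algebra_simps)
  qed
  have "(- u, - x) \<in> G"
  proof (rule max)
    fix a \<alpha> assume "(a, \<alpha>) \<in> G"
    have "0 \<le> (x + u) \<bullet> (x + u)" by simp
    also note optimal[OF \<open>(a, \<alpha>) \<in> G\<close>]
    also have "(a + u) \<bullet> (\<alpha> + x) = (- u - a) \<bullet> (- x - \<alpha>)"
      by (simp add: inner_add_left inner_add_right inner_diff_left inner_diff_right)
    finally show "0 \<le> (- u - a) \<bullet> (- x - \<alpha>)" .
  qed
  \<comment> \<open>At the graph point \<open>(- u, - x)\<close> the right-hand side of
    \<open>optimal\<close> vanishes.\<close>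
  moreover from this have "(x + u) \<bullet> (x + u) \<le> 0" using optimal by fastforce
  then have "x + u = 0" by (metis inner_ge_zero inner_eq_zero_iff order_antisym)
  then have "- u = x" by (metis add.commute minus_unique)
  ultimately show ?thesis by auto
qed

section \<open>Maximal monotone operators and their resolvents\<close>

text \<open>Adjoining the pair to the graph keeps it monotone, so by maximality it was there
  already.\<close>

lemma maximal_monotone_opD:
  assumes "maximal_monotone_op A"
    and "\<And>a \<alpha>. \<alpha> \<in> A a \<Longrightarrow> (x - a) \<bullet> (u - \<alpha>) \<ge> 0"
  shows "u \<in> A x"
proof -
  have rev: "(a - x) \<bullet> (\<alpha> - u) \<ge> 0" if "\<alpha> \<in> A a" for a \<alpha>
    using assms(2)[OF that] by (simp add: inner_diff_left inner_diff_right)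
  have "monotone_op (A(x := insert u (A x)))"
    using assms rev unfolding monotone_op_def maximal_monotone_op_def by auto
  moreover have "A \<le> A(x := insert u (A x))" by (auto simp: le_fun_def)
  ultimately have "A(x := insert u (A x)) = A"
    using assms(1) by (auto simp: maximal_monotone_op_def)
  from fun_cong[OF this, of x] show ?thesis by auto
qed

text \<open>Scaling the values of \<open>A\<close> by \<open>c\<close> and shifting them by
  \<open>- z\<close> preserves maximal monotonicity; a point of the new graph on the antidiagonal
  satisfies \<open>- y = c *\<^sub>R u - z\<close>.\<close>

theorem Minty:
  fixes A :: "'a::{real_inner, complete_space} \<Rightarrow> 'a set"
  assumes A: "maximal_monotone_op A" and "0 < c"
  shows "\<exists>y. \<exists>u\<in>A y. z = y + c *\<^sub>R u"
proof -
  define G where "G = {(y, c *\<^sub>R u - z) | y u. u \<in> A y}"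
  have mono: "(x - y) \<bullet> (u - v) \<ge> 0" if "u \<in> A x" "v \<in> A y" for x y u v
    using A that by (auto simp: maximal_monotone_op_def monotone_op_def)
  have "\<exists>x. (x, - x) \<in> G"
  proof (rule maximal_monotone_graph_meets_antidiagonal)
    fix a \<alpha> b \<beta> assume "(a, \<alpha>) \<in> G" "(b, \<beta>) \<in> G"
    then obtain u v where uv: "\<alpha> = c *\<^sub>R u - z" "\<beta> = c *\<^sub>R v - z" "u \<in> A a" "v \<in> A b"
      by (auto simp: G_def)
    have "\<alpha> - \<beta> = c *\<^sub>R (u - v)" by (simp add: uv(1,2) scaleR_diff_right)
    with uv show "0 \<le> (a - b) \<bullet> (\<alpha> - \<beta>)" using mono \<open>0 < c\<close> by simp
  next
    fix x u assume *: "\<And>a \<alpha>. (a, \<alpha>) \<in> G \<Longrightarrow> 0 \<le> (x - a) \<bullet> (u - \<alpha>)"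
    have "(1 / c) *\<^sub>R (u + z) \<in> A x"
    proof (rule maximal_monotone_opD[OF A])
      fix a \<alpha> assume "\<alpha> \<in> A a"
      then have "0 \<le> (x - a) \<bullet> (u - (c *\<^sub>R \<alpha> - z))" by (intro *) (auto simp: G_def)
      also have "u - (c *\<^sub>R \<alpha> - z) = c *\<^sub>R ((1 / c) *\<^sub>R (u + z) - \<alpha>)"
        using \<open>0 < c\<close> by (simp add: algebra_simps)
      finally show "0 \<le> (x - a) \<bullet> ((1 / c) *\<^sub>R (u + z) - \<alpha>)"
        using \<open>0 < c\<close> by (simp add: zero_le_mult_iff)
    qed
    moreover have "u = c *\<^sub>R ((1 / c) *\<^sub>R (u + z)) - z" using \<open>0 < c\<close> by simp
    ultimately show "(x, u) \<in> G" unfolding G_def by blast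
  qed
  then obtain y u where "u \<in> A y" "- y = c *\<^sub>R u - z" by (auto simp: G_def)
  then have "u \<in> A y" "z = y + c *\<^sub>R u" by (simp_all add: algebra_simps)
  then show ?thesis by blast
qed

text \<open>Two representations of \<open>z\<close> differ by \<open>c (v - u) = - (w - y)\<close>,
  so monotonicity makes \<open>- (w - y) \<bullet> (w - y)\<close> nonnegative.\<close>

lemma resolvent_eqI:
  assumes "monotone_op A" "0 < c" "u \<in> A y" "z = y + c *\<^sub>R u"
  shows "resolvent c A z = y"
  unfolding resolvent_def
proof (rule the_equality)
  show "z \<in> {y + c *\<^sub>R u | u. u \<in> A y}" using assms by auto
next
  fix w assume "z \<in> {w + c *\<^sub>R u | u. u \<in> A w}"
  then obtain v where v: "v \<in> A w" "z = w + c *\<^sub>R v" by auto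
  have "0 \<le> c * ((w - y) \<bullet> (v - u))" using assms v by (auto simp: monotone_op_def)
  also have "\<dots> = (w - y) \<bullet> (c *\<^sub>R v - c *\<^sub>R u)" by (simp add: inner_diff_right algebra_simps)
  also have "c *\<^sub>R v - c *\<^sub>R u = - (w - y)" using assms v by (simp add: algebra_simps)
  finally have "(w - y) \<bullet> (w - y) \<le> 0" unfolding inner_minus_right by simp
  then show "w = y" by (metis inner_ge_zero inner_eq_zero_iff order_antisym right_minus_eq)
qed

text \<open>Once Minty's theorem represents both arguments, the claim is \<open>c\<close> times the
  monotonicity inequality.\<close>

lemma resolvent_firmly_nonexpansive:
  fixes A :: "'a::{real_inner, complete_space} \<Rightarrow> 'a set"
  assumes A: "maximal_monotone_op A" and "0 < c"
  defines "J \<equiv> resolvent c A"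
  shows "0 \<le> (J z - J w) \<bullet> ((z - w) - (J z - J w))"
proof -
  have mono: "monotone_op A" using A by (simp add: maximal_monotone_op_def)
  obtain y u where y: "u \<in> A y" "z = y + c *\<^sub>R u" using Minty[OF A \<open>0 < c\<close>] by blast
  obtain y' u' where y': "u' \<in> A y'" "w = y' + c *\<^sub>R u'" using Minty[OF A \<open>0 < c\<close>] by blast
  have J: "J z = y" "J w = y'"
    unfolding J_def using resolvent_eqI[OF mono \<open>0 < c\<close>] y y' by auto
  have "0 \<le> c * ((y - y') \<bullet> (u - u'))"
    using mono y(1) y'(1) \<open>0 < c\<close> by (auto simp: monotone_op_def)
  also have "\<dots> = (y - y') \<bullet> ((z - w) - (y - y'))"
    using y(2) y'(2) by (simp add: inner_diff_right inner_add_right algebra_simps)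
  finally show ?thesis by (simp add: J)
qed

text \<open>The certificate is the identity
  \<open>2 (2\<delta> - \<gamma>) (q \<bullet> d) + \<gamma> \<parallel>d\<parallel>\<^sup>2 - (4\<delta> - \<gamma>) \<parallel>q\<parallel>\<^sup>2
    = 4\<delta> (q \<bullet> (d - \<gamma> e - q)) + 4\<delta>\<gamma> (d \<bullet> e - \<delta> \<parallel>e\<parallel>\<^sup>2) + \<gamma> \<parallel>d - q - 2\<delta> e\<parallel>\<^sup>2\<close>
  with \<open>d = u - v\<close>, \<open>e = T2 u - T2 v\<close> and \<open>q = FB u - FB v\<close>.\<close>

lemma forward_backward_averaged:
  fixes T1 :: "'a::{real_inner, complete_space} \<Rightarrow> 'a set"
  assumes T1: "maximal_monotone_op T1" and T2: "cocoercive \<delta> T2"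
    and \<gamma>: "0 < \<gamma>" "\<gamma> \<le> 2 * \<delta>"
  defines "FB \<equiv> \<lambda>u. resolvent \<gamma> T1 (u - \<gamma> *\<^sub>R T2 u)"
    and "\<alpha> \<equiv> 2 * \<delta> / (4 * \<delta> - \<gamma>)"
  shows "norm (FB u - FB v - (1 - \<alpha>) *\<^sub>R (u - v)) \<le> \<alpha> * norm (u - v)"
proof -
  define d where "d = u - v"
  define e where "e = T2 u - T2 v"
  define q where "q = FB u - FB v"
  have pos: "0 < \<delta>" "0 < 4 * \<delta> - \<gamma>" using \<gamma> by auto
  have "(u - \<gamma> *\<^sub>R T2 u) - (v - \<gamma> *\<^sub>R T2 v) = d - \<gamma> *\<^sub>R e"
    by (simp add: d_def e_def algebra_simps)
  then have firm: "0 \<le> q \<bullet> (d - \<gamma> *\<^sub>R e - q)"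
    using resolvent_firmly_nonexpansive[OF T1 \<gamma>(1), of "u - \<gamma> *\<^sub>R T2 u" "v - \<gamma> *\<^sub>R T2 v"]
    by (simp add: q_def FB_def)
  have coco: "0 \<le> d \<bullet> e - \<delta> * (e \<bullet> e)"
    using T2 by (simp add: cocoercive_def d_def e_def power2_norm_eq_inner)
  have "0 \<le> 4 * \<delta> * (q \<bullet> (d - \<gamma> *\<^sub>R e - q)) + 4 * \<delta> * \<gamma> * (d \<bullet> e - \<delta> * (e \<bullet> e))
      + \<gamma> * ((d - q - (2 * \<delta>) *\<^sub>R e) \<bullet> (d - q - (2 * \<delta>) *\<^sub>R e))"
    using firm coco pos \<gamma> by (intro add_nonneg_nonneg mult_nonneg_nonneg) auto
  also have "\<dots> = 2 * (2 * \<delta> - \<gamma>) * (q \<bullet> d) + \<gamma> * (d \<bullet> d) - (4 * \<delta> - \<gamma>) * (q \<bullet> q)"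
    by (simp add: inner_diff_left inner_diff_right inner_commute algebra_simps)
  also have "\<dots> = (4 * \<delta> - \<gamma>) * (2 * (1 - \<alpha>) * (q \<bullet> d) + (2 * \<alpha> - 1) * (d \<bullet> d) - q \<bullet> q)"
  proof -
    have "(4 * \<delta> - \<gamma>) * (1 - \<alpha>) = 2 * \<delta> - \<gamma>" "(4 * \<delta> - \<gamma>) * (2 * \<alpha> - 1) = \<gamma>"
      using pos by (auto simp: \<alpha>_def field_simps)
    then show ?thesis by algebra
  qed
  finally have "0 \<le> 2 * (1 - \<alpha>) * (q \<bullet> d) + (2 * \<alpha> - 1) * (d \<bullet> d) - q \<bullet> q"
    using pos by (simp add: zero_le_mult_iff)
  \<comment> \<open>Completing the square, with
    \<open>2 * \<alpha> - 1 = \<alpha>\<^sup>2 - (1 - \<alpha>)\<^sup>2\<close>.\<close>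
  also have "\<dots> = (\<alpha> * norm d)\<^sup>2 - (norm (q - (1 - \<alpha>) *\<^sub>R d))\<^sup>2"
    unfolding power_mult_distrib power2_norm_eq_inner
    by (simp add: inner_diff_left inner_diff_right inner_commute algebra_simps power2_eq_square)
  finally have "(norm (q - (1 - \<alpha>) *\<^sub>R d))\<^sup>2 \<le> (\<alpha> * norm d)\<^sup>2" by simp
  then show ?thesis
    unfolding q_def d_def by (rule power2_le_imp_le) (use pos in \<open>simp add: \<alpha>_def\<close>)
qed

section \<open>Metastability of the regularised Krasnoselskii-Mann iteration\<close>

text \<open>Quantitative convexity of the fixed point set. Only the squared defect is linear in
  \<open>\<epsilon>\<close>; this loss is the source of the squares \<open>(m + 1)\<^sup>2\<close>
  in \<open>rate_psi\<close>.\<close>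

lemma convex_comb_approx_fixpoint:
  fixes T :: "'a::real_inner \<Rightarrow> 'a"
  assumes T: "\<And>u v. norm (T u - T v) \<le> norm (u - v)"
    and a: "norm (T a - a) \<le> \<epsilon>" and b: "norm (T b - b) \<le> \<epsilon>"
    and t: "0 \<le> t" "t \<le> 1"
  defines "w \<equiv> (1 - t) *\<^sub>R a + t *\<^sub>R b"
  shows "(norm (T w - w))\<^sup>2 \<le> \<epsilon> * norm (a - b) + \<epsilon>\<^sup>2"
proof -
  define d where "d = norm (a - b)"
  have "0 \<le> \<epsilon>" using a norm_ge_zero order_trans by blast
  have "w - a = t *\<^sub>R (b - a)" "w - b = (1 - t) *\<^sub>R (a - b)" by (simp_all add: w_def algebra_simps)
  then have wa: "norm (w - a) = t * d" and wb: "norm (w - b) = (1 - t) * d"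
    using t by (simp_all add: d_def norm_minus_commute)
  have "norm (T w - a) \<le> norm (T w - T a) + norm (T a - a)"
    using norm_triangle_ineq[of "T w - T a" "T a - a"] by simp
  then have 1: "norm (T w - a) \<le> t * d + \<epsilon>" using T[of w a] a wa by linarith
  have "norm (T w - b) \<le> norm (T w - T b) + norm (T b - b)"
    using norm_triangle_ineq[of "T w - T b" "T b - b"] by simp
  then have 2: "norm (T w - b) \<le> (1 - t) * d + \<epsilon>" using T[of w b] b wb by linarith
  \<comment> \<open>Squared norm of a convex combination. In the bound that follows the
    \<open>d\<^sup>2\<close> terms cancel, leaving
    \<open>4 t (1 - t) \<epsilon> d + \<epsilon>\<^sup>2\<close>.\<close>
  have "(norm (T w - w))\<^sup>2
      = (1 - t) * (norm (T w - a))\<^sup>2 + t * (norm (T w - b))\<^sup>2 - t * (1 - t) * d\<^sup>2"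
    unfolding power2_norm_eq_inner w_def d_def
    by (simp add: inner_add_left inner_add_right inner_diff_left inner_diff_right
        inner_commute algebra_simps)
  also have "\<dots> \<le> (1 - t) * (t * d + \<epsilon>)\<^sup>2 + t * ((1 - t) * d + \<epsilon>)\<^sup>2 - t * (1 - t) * d\<^sup>2"
    using 1 2 t by (intro diff_right_mono add_mono mult_left_mono power_mono) auto
  also have "\<dots> = \<epsilon> * d + \<epsilon>\<^sup>2 - \<epsilon> * d * (1 - 2 * t)\<^sup>2"
    by (simp add: power2_eq_square algebra_simps)
  also have "\<dots> \<le> \<epsilon> * d + \<epsilon>\<^sup>2" using \<open>0 \<le> \<epsilon>\<close> by (simp add: d_def)
  finally show ?thesis by (simp add: d_def)
qed

text \<open>A quantitative substitute for the projection of \<open>0\<close> onto the fixed point set: as long as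
  the current approximate fixed point \<open>w\<close> admits a bad \<open>q\<close>, moving towards \<open>q\<close> decreases
  \<open>\<parallel>w\<parallel>\<^sup>2\<close> by at least \<open>1 / (4 N\<^sup>2 (k + 1)\<^sup>2)\<close>.\<close>

lemma approx_projection:
  fixes T :: "'a::real_inner \<Rightarrow> 'a" and \<rho> :: "nat \<Rightarrow> nat"
  assumes T: "\<And>u v. norm (T u - T v) \<le> norm (u - v)"
    and p: "T p = p" "norm p \<le> real N" and N: "0 < N"
    and \<rho>: "\<And>m. 48 * N * (m + 1)\<^sup>2 \<le> \<rho> m"
    and R: "4 * N ^ 4 * (k + 1)\<^sup>2 < R"
  shows "\<exists>i<R. \<exists>w. norm (w - p) \<le> real N \<and> norm (T w - w) \<le> 1 / (real ((\<rho> ^^ Suc i) 0) + 1) \<and>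
    (\<forall>q. norm (q - p) \<le> real N
      \<longrightarrow> norm (T q - q) \<le> 1 / (real (48 * N * ((\<rho> ^^ i) 0 + 1)\<^sup>2) + 1)
      \<longrightarrow> w \<bullet> (w - q) \<le> 1 / (real k + 1))"
proof (rule ccontr)
  assume contra: "\<not> ?thesis"
  define \<kappa> where "\<kappa> = real k + 1"
  define n where "n = real N"
  have pos: "0 < \<kappa>" "1 \<le> \<kappa>" "1 \<le> n" "0 < n" using N by (auto simp: \<kappa>_def n_def)
  \<comment> \<open>Here \<open>j\<close> counts the moves, starting from the exact fixed point
    \<open>p\<close>. Each move loses accuracy, so the iterates of \<open>\<rho>\<close> are
    traversed downwards.\<close>
  have "\<exists>w. norm (w - p) \<le> n \<and> norm (T w - w) \<le> 1 / (real ((\<rho> ^^ (R - j)) 0) + 1) \<and>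
      (norm w)\<^sup>2 \<le> n\<^sup>2 - real j / (4 * n\<^sup>2 * \<kappa>\<^sup>2)" if "j \<le> R" for j
    using that
  proof (induction j)
    case 0
    show ?case using p pos by (intro exI[of _ p]) (auto simp: n_def intro: power_mono)
  next
    case (Suc j)
    define i where "i = R - Suc j"
    then have i: "R - j = Suc i" "i < R" using Suc.prems by auto
    define m where "m = (\<rho> ^^ i) 0"
    obtain w where w: "norm (w - p) \<le> n" "norm (T w - w) \<le> 1 / (real ((\<rho> ^^ Suc i) 0) + 1)"
      "(norm w)\<^sup>2 \<le> n\<^sup>2 - real j / (4 * n\<^sup>2 * \<kappa>\<^sup>2)"
      using Suc.IH Suc.prems i by auto
    then obtain q where q: "norm (q - p) \<le> n"
      "norm (T q - q) \<le> 1 / (real (48 * N * (m + 1)\<^sup>2) + 1)" "1 / \<kappa> < w \<bullet> (w - q)"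
      using contra i(2) unfolding m_def n_def \<kappa>_def by (metis not_le)
    \<comment> \<open>This \<open>t\<close> minimises
      \<open>4 n\<^sup>2 t\<^sup>2 - 2 t / \<kappa>\<close>, a bound for the change of the squared
      norm; the minimum is \<open>- 1 / (4 n\<^sup>2 \<kappa>\<^sup>2)\<close>.\<close>
    define t where "t = 1 / (4 * n\<^sup>2 * \<kappa>)"
    have "4 * 1 * 1 \<le> 4 * n\<^sup>2 * \<kappa>" using pos by (intro mult_mono) auto
    then have t: "0 \<le> t" "t \<le> 1" using pos by (auto simp: t_def)
    define v where "v = (1 - t) *\<^sub>R w + t *\<^sub>R q"
    have wq: "norm (w - q) \<le> 2 * n"
      using norm_triangle_ineq4[of "w - p" "q - p"] w(1) q(1) by simp
    have "v - p = (1 - t) *\<^sub>R (w - p) + t *\<^sub>R (q - p)" by (simp add: v_def algebra_simps)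
    then have "norm (v - p) \<le> (1 - t) * norm (w - p) + t * norm (q - p)"
      using t norm_triangle_ineq[of "(1 - t) *\<^sub>R (w - p)" "t *\<^sub>R (q - p)"] by simp
    also have "\<dots> \<le> (1 - t) * n + t * n" using t w q by (intro add_mono mult_left_mono) auto
    finally have v1: "norm (v - p) \<le> n" by (simp add: algebra_simps)
    define M where "M = real m + 1"
    have M: "1 \<le> M" by (simp add: M_def)
    define \<epsilon> where "\<epsilon> = 1 / (48 * n * M\<^sup>2 + 1)"
    have "1 * 1 \<le> n * M\<^sup>2" using pos M by (intro mult_mono) auto
    then have nM: "1 \<le> n * M\<^sup>2" by simp
    then have \<epsilon>: "0 < \<epsilon>" "\<epsilon> \<le> 1 / (48 * n * M\<^sup>2)" "\<epsilon> \<le> 1"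
      unfolding \<epsilon>_def by (auto intro!: frac_le simp: algebra_simps)
    have \<epsilon>_eq: "\<epsilon> = 1 / (real (48 * N * (m + 1)\<^sup>2) + 1)" by (simp add: \<epsilon>_def n_def M_def)
    have "1 / (real ((\<rho> ^^ Suc i) 0) + 1) \<le> \<epsilon>"
      unfolding \<epsilon>_eq using \<rho>[of m]
      by (intro divide_left_mono) (auto simp: m_def simp del: of_nat_add of_nat_mult)
    then have "norm (T w - w) \<le> \<epsilon>" "norm (T q - q) \<le> \<epsilon>" using w(2) q(2) by (auto simp: \<epsilon>_eq)
    then have "(norm (T v - v))\<^sup>2 \<le> \<epsilon> * norm (w - q) + \<epsilon>\<^sup>2"
      unfolding v_def using t by (intro convex_comb_approx_fixpoint T)
    also have "\<dots> \<le> \<epsilon> * (2 * n) + \<epsilon> * 1"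
      unfolding power2_eq_square using \<epsilon> wq by (intro add_mono mult_left_mono) auto
    also have "\<dots> \<le> \<epsilon> * (3 * n)" using \<epsilon> pos by (simp add: algebra_simps)
    also have "\<dots> \<le> 1 / (48 * n * M\<^sup>2) * (3 * n)" using \<epsilon> pos by (intro mult_right_mono) auto
    also have "\<dots> = (1 / 16) / M\<^sup>2" using pos by (simp add: field_simps)
    also have "\<dots> \<le> 1 / M\<^sup>2" by (intro divide_right_mono) auto
    also have "\<dots> = (1 / M)\<^sup>2" by (simp add: power_divide)
    finally have v2: "norm (T v - v) \<le> 1 / M"
      by (rule power2_le_imp_le) (use M in simp)
    have v_eq: "v = w - t *\<^sub>R (w - q)" by (simp add: v_def algebra_simps)
    have "(norm (w - t *\<^sub>R d))\<^sup>2 = (norm w)\<^sup>2 - 2 * t * (w \<bullet> d) + t\<^sup>2 * (norm d)\<^sup>2" for d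
      unfolding power2_norm_eq_inner
      by (simp add: inner_diff_left inner_diff_right inner_commute[of d w]
          algebra_simps power2_eq_square)
    then have "(norm v)\<^sup>2 = (norm w)\<^sup>2 - 2 * t * (w \<bullet> (w - q)) + t\<^sup>2 * (norm (w - q))\<^sup>2"
      unfolding v_eq .
    also have "\<dots> \<le> (n\<^sup>2 - real j / (4 * n\<^sup>2 * \<kappa>\<^sup>2)) - 2 * t * (1 / \<kappa>) + t\<^sup>2 * (2 * n)\<^sup>2"
      using w(3) q(3) t wq by (intro add_mono diff_mono mult_left_mono power_mono) auto
    also have "\<dots> = n\<^sup>2 - real (Suc j) / (4 * n\<^sup>2 * \<kappa>\<^sup>2)"
    proof -
      have "t * (1 / \<kappa>) = 1 / (4 * n\<^sup>2 * \<kappa>\<^sup>2)" by (simp add: t_def power2_eq_square)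
      moreover have "t\<^sup>2 * (2 * n)\<^sup>2 = 1 / (4 * n\<^sup>2 * \<kappa>\<^sup>2)"
        using pos by (simp add: t_def power2_eq_square)
      moreover have "real (Suc j) / (4 * n\<^sup>2 * \<kappa>\<^sup>2)
          = real j / (4 * n\<^sup>2 * \<kappa>\<^sup>2) + 1 / (4 * n\<^sup>2 * \<kappa>\<^sup>2)"
        by (simp add: add_divide_distrib)
      ultimately show ?thesis by linarith
    qed
    finally show ?case using v1 v2 by (auto simp: i_def[symmetric] m_def[symmetric] M_def)
  qed
  \<comment> \<open>After \<open>R\<close> moves the total decrease exceeds the initial
    \<open>n\<^sup>2\<close>.\<close>
  from this[of R] obtain w where "(norm (w::'a))\<^sup>2 \<le> n\<^sup>2 - real R / (4 * n\<^sup>2 * \<kappa>\<^sup>2)" by auto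
  then have "real R / (4 * n\<^sup>2 * \<kappa>\<^sup>2) \<le> n\<^sup>2" using zero_le_power2[of "norm w"] by linarith
  then have "real R \<le> n\<^sup>2 * (4 * n\<^sup>2 * \<kappa>\<^sup>2)" using pos by (simp add: pos_divide_le_eq)
  also have "\<dots> = real (4 * N ^ 4 * (k + 1)\<^sup>2)"
    by (simp add: n_def \<kappa>_def power2_eq_square power4_eq_xxxx algebra_simps)
  finally show False using R by linarith
qed

text \<open>Unrolling damps the initial value by the product, keeps \<open>c\<close> because
  \<open>\<beta> n * c + (1 - \<beta> n) * c = c\<close>, and at worst adds up the errors since
  \<open>\<beta> n \<le> 1\<close>.\<close>

lemma recursive_inequality_bound:
  fixes s \<beta> e :: "nat \<Rightarrow> real"
  assumes step: "\<And>n. m \<le> n \<Longrightarrow> s (Suc n) \<le> \<beta> n * s n + (1 - \<beta> n) * c + e n"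
    and \<beta>: "\<And>n. 0 \<le> \<beta> n" "\<And>n. \<beta> n \<le> 1" and e: "\<And>n. 0 \<le> e n" and c: "0 \<le> c"
    and "m \<le> n"
  shows "s n \<le> (\<Prod>i=m..<n. \<beta> i) * s m + c + (\<Sum>i=m..<n. e i)"
  using \<open>m \<le> n\<close>
proof (induction n rule: dec_induct)
  case base
  then show ?case using c by simp
next
  case (step n)
  have "s (Suc n) \<le> \<beta> n * s n + (1 - \<beta> n) * c + e n" using assms(1) step by simp
  also have "\<dots> \<le> \<beta> n * ((\<Prod>i=m..<n. \<beta> i) * s m + c + (\<Sum>i=m..<n. e i)) + (1 - \<beta> n) * c + e n"
    using step.IH \<beta> by (intro add_right_mono mult_left_mono) auto
  also have "\<dots> = (\<Prod>i=m..<Suc n. \<beta> i) * s m + c + \<beta> n * (\<Sum>i=m..<n. e i) + e n"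
    using step.hyps by (simp add: algebra_simps prod.atLeastLessThan_Suc)
  also have "\<beta> n * (\<Sum>i=m..<n. e i) \<le> 1 * (\<Sum>i=m..<n. e i)"
    using \<beta> e by (intro mult_right_mono sum_nonneg) auto
  finally show ?case using step.hyps by (simp add: sum.atLeastLessThan_Suc)
qed

section \<open>Boundedness and asymptotic regularity of the iteration\<close>

text \<open>Here \<open>lam\<close> and \<open>l\<close> are relative to the nonexpansive
  \<open>T\<close>: the forward-backward iteration enters with \<open>\<alpha> * lam n\<close> and
  \<open>2 * l\<close>.\<close>

locale regularised_iteration =
  fixes T :: "'a::real_inner \<Rightarrow> 'a" and p :: 'a and x :: "nat \<Rightarrow> 'a"
    and \<beta> lam :: "nat \<Rightarrow> real" and N l :: nat and b D B L :: "nat \<Rightarrow> nat"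
  assumes nonexp: "norm (T u - T v) \<le> norm (u - v)"
    and fix_p: "T p = p"
    and norm_p: "norm p \<le> real N" and dist_x0: "norm (x 0 - p) \<le> real N"
    and N_pos: "0 < N" and l_pos: "0 < l"
    and \<beta>_pos: "0 < \<beta> n" and \<beta>_le: "\<beta> n \<le> 1"
    and lam_pos: "0 < lam n" and lam_le: "lam n \<le> 1"
    and lam_ge: "1 / real l \<le> lam n"
    and iterate: "x (Suc n) = (1 - lam n) *\<^sub>R (\<beta> n *\<^sub>R x n) + lam n *\<^sub>R T (\<beta> n *\<^sub>R x n)"
    and mono_b: "mono b" and mono_D: "mono D" and mono_B: "mono B" and mono_L: "mono L"
    and b_rate: "b k \<le> n \<Longrightarrow> 1 - \<beta> n \<le> 1 / (real k + 1)"
    and D_rate: "real k \<le> (\<Sum>i = 1..D k. 1 - \<beta> i)"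
    and B_rate: "(\<Sum>i = B k + 1..B k + n. \<bar>\<beta> i - \<beta> (i - 1)\<bar>) \<le> 1 / (real k + 1)"
    and L_rate: "(\<Sum>i = L k + 1..L k + n. \<bar>lam i - lam (i - 1)\<bar>) \<le> 1 / (real k + 1)"
begin

definition y :: "nat \<Rightarrow> 'a" where "y n = \<beta> n *\<^sub>R x n"

abbreviation nu1 :: "nat \<Rightarrow> nat" where "nu1 \<equiv> rate_nu1 N D B L"
abbreviation nu2 :: "nat \<Rightarrow> nat" where "nu2 \<equiv> rate_nu2 N l b D B L"

lemma norm_T_p: "norm (T u - p) \<le> norm (u - p)"
  using nonexp[of u p] fix_p by simp

lemma relaxed_nonexp:
  "norm (((1 - lam n) *\<^sub>R u + lam n *\<^sub>R T u) - ((1 - lam n) *\<^sub>R v + lam n *\<^sub>R T v)) \<le> norm (u - v)"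
proof -
  have "((1 - lam n) *\<^sub>R u + lam n *\<^sub>R T u) - ((1 - lam n) *\<^sub>R v + lam n *\<^sub>R T v)
      = (1 - lam n) *\<^sub>R (u - v) + lam n *\<^sub>R (T u - T v)" by (simp add: algebra_simps)
  also have "norm \<dots> \<le> (1 - lam n) * norm (u - v) + lam n * norm (T u - T v)"
    using norm_triangle_ineq[of "(1 - lam n) *\<^sub>R (u - v)" "lam n *\<^sub>R (T u - T v)"]
      lam_pos[of n] lam_le[of n] by simp
  also have "\<dots> \<le> (1 - lam n) * norm (u - v) + lam n * norm (u - v)"
    using nonexp[of u v] lam_pos[of n] by simp
  finally show ?thesis by (simp add: algebra_simps)
qed

lemma x_Suc: "x (Suc n) = (1 - lam n) *\<^sub>R y n + lam n *\<^sub>R T (y n)"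
  unfolding y_def by (rule iterate)

text \<open>The point \<open>y n\<close> is a convex combination of \<open>x n\<close> and 0, and
  \<open>norm_p\<close> puts 0 into the ball around \<open>p\<close>.\<close>

lemma y_ball_if_x_ball:
  assumes "norm (x n - p) \<le> real N"
  shows "norm (y n - p) \<le> real N"
proof -
  have "y n - p = \<beta> n *\<^sub>R (x n - p) - (1 - \<beta> n) *\<^sub>R p" by (simp add: y_def algebra_simps)
  then have "norm (y n - p) \<le> \<beta> n * norm (x n - p) + (1 - \<beta> n) * norm p"
    using norm_triangle_ineq4[of "\<beta> n *\<^sub>R (x n - p)" "(1 - \<beta> n) *\<^sub>R p"] \<beta>_pos[of n] \<beta>_le[of n]
    by simp
  also have "\<dots> \<le> \<beta> n * real N + (1 - \<beta> n) * real N"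
    using assms norm_p \<beta>_pos[of n] \<beta>_le[of n] by (intro add_mono mult_left_mono) auto
  finally show ?thesis by (simp add: algebra_simps)
qed

lemma x_ball: "norm (x n - p) \<le> real N"
proof (induction n)
  case 0
  show ?case by (rule dist_x0)
next
  case (Suc n)
  have "p = (1 - lam n) *\<^sub>R p + lam n *\<^sub>R T p" by (simp add: fix_p algebra_simps)
  then have "norm (x (Suc n) - p) \<le> norm (y n - p)"
    unfolding x_Suc using relaxed_nonexp[of n "y n" p] by metis
  with y_ball_if_x_ball[OF Suc.IH] show ?case by simp
qed

lemma y_ball: "norm (y n - p) \<le> real N"
  by (intro y_ball_if_x_ball x_ball)

lemma norm_x: "norm (x n) \<le> 2 * real N"
  using norm_triangle_ineq[of "x n - p" p] x_ball[of n] norm_p by simp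

lemma norm_T_y: "norm (T (y n) - y n) \<le> 2 * real N"
  using norm_triangle_ineq4[of "T (y n) - p" "y n - p"] norm_T_p[of "y n"] y_ball[of n] by simp

text \<open>Compare \<open>y (Suc n)\<close> and \<open>y n\<close> under the same relaxed map; the
  changes of \<open>lam\<close> and \<open>\<beta>\<close> then cost multiples of
  \<open>norm_T_y\<close> and \<open>norm_x\<close>.\<close>

lemma displacement_step:
  "norm (x (Suc (Suc n)) - x (Suc n)) \<le> \<beta> (Suc n) * norm (x (Suc n) - x n)
    + (2 * real N * \<bar>\<beta> (Suc n) - \<beta> n\<bar> + 2 * real N * \<bar>lam (Suc n) - lam n\<bar>)"
proof -
  have "x (Suc (Suc n)) - x (Suc n)
      = (((1 - lam (Suc n)) *\<^sub>R y (Suc n) + lam (Suc n) *\<^sub>R T (y (Suc n)))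
        - ((1 - lam (Suc n)) *\<^sub>R y n + lam (Suc n) *\<^sub>R T (y n)))
        + (lam (Suc n) - lam n) *\<^sub>R (T (y n) - y n)"
    unfolding x_Suc by (simp add: algebra_simps)
  also have "norm \<dots> \<le> norm (y (Suc n) - y n) + norm ((lam (Suc n) - lam n) *\<^sub>R (T (y n) - y n))"
    by (intro order_trans[OF norm_triangle_ineq] add_right_mono relaxed_nonexp)
  also have "norm ((lam (Suc n) - lam n) *\<^sub>R (T (y n) - y n))
      = \<bar>lam (Suc n) - lam n\<bar> * norm (T (y n) - y n)" by simp
  also have "\<bar>lam (Suc n) - lam n\<bar> * norm (T (y n) - y n) \<le> \<bar>lam (Suc n) - lam n\<bar> * (2 * real N)"
    using norm_T_y by (intro mult_left_mono) auto
  also have "y (Suc n) - y n = \<beta> (Suc n) *\<^sub>R (x (Suc n) - x n) + (\<beta> (Suc n) - \<beta> n) *\<^sub>R x n"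
    by (simp add: y_def algebra_simps)
  also have "norm \<dots> \<le> \<beta> (Suc n) * norm (x (Suc n) - x n) + \<bar>\<beta> (Suc n) - \<beta> n\<bar> * norm (x n)"
    using norm_triangle_ineq[of "\<beta> (Suc n) *\<^sub>R (x (Suc n) - x n)" "(\<beta> (Suc n) - \<beta> n) *\<^sub>R x n"]
      \<beta>_pos[of "Suc n"] by simp
  also have "\<bar>\<beta> (Suc n) - \<beta> n\<bar> * norm (x n) \<le> \<bar>\<beta> (Suc n) - \<beta> n\<bar> * (2 * real N)"
    using norm_x by (intro mult_left_mono) auto
  finally show ?thesis by (simp add: mult.commute)
qed

text \<open>All summands in \<open>D_rate\<close> are at most 1. This places the stages given by
  \<open>D\<close> after the start \<open>Suc m\<close> of the recursions.\<close>

lemma le_D: "k \<le> D k"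
proof -
  have "(\<Sum>i = 1..D k. 1 - \<beta> i) \<le> (\<Sum>i = 1..D k. 1)"
    using \<beta>_pos by (intro sum_mono) (simp add: less_imp_le)
  then have "real k \<le> real (D k)" using D_rate[of k] by simp
  then show ?thesis by simp
qed

text \<open>Since \<open>\<beta> i \<le> exp (\<beta> i - 1)\<close>, it suffices that the sum of
  \<open>1 - \<beta> i\<close> over the window is at least \<open>ln K\<close>. The first
  \<open>m\<close> terms contribute at most \<open>m\<close>, hence the argument \<open>m\<close>
  plus the ceiling.\<close>

lemma prod_\<beta>_le:
  fixes K :: nat
  assumes n: "D (m + nat \<lceil>ln (real K)\<rceil>) + 1 \<le> n" and K: "0 < K"
  shows "(\<Prod>i = Suc m..<n. \<beta> i) \<le> 1 / real K"
proof -
  define c where "c = nat \<lceil>ln (real K)\<rceil>"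
  have c: "ln (real K) \<le> real c" by (simp add: c_def) linarith
  have "real (m + c) \<le> (\<Sum>i = 1..D (m + c). 1 - \<beta> i)" by (rule D_rate)
  also have "\<dots> \<le> (\<Sum>i \<in> {1..m} \<union> {Suc m..<n}. 1 - \<beta> i)"
    using n \<beta>_le by (intro sum_mono2) (auto simp: c_def[symmetric])
  also have "\<dots> = (\<Sum>i = 1..m. 1 - \<beta> i) + (\<Sum>i = Suc m..<n. 1 - \<beta> i)"
    by (intro sum.union_disjoint) auto
  also have "(\<Sum>i = 1..m. 1 - \<beta> i) \<le> (\<Sum>i = 1..m. 1)"
    using \<beta>_pos by (intro sum_mono) (simp add: less_imp_le)
  finally have S: "ln (real K) \<le> (\<Sum>i = Suc m..<n. 1 - \<beta> i)" using c by simp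
  have "(\<Prod>i = Suc m..<n. \<beta> i) \<le> (\<Prod>i = Suc m..<n. exp (\<beta> i - 1))"
    using \<beta>_pos exp_ge_add_one_self[of "\<beta> _ - 1"]
    by (intro prod_mono) (simp add: less_imp_le)
  also have "\<dots> = exp (- (\<Sum>i = Suc m..<n. 1 - \<beta> i))"
    by (simp add: exp_sum[symmetric] sum_negf[symmetric])
  also have "\<dots> \<le> exp (- ln (real K))" using S by simp
  also have "\<dots> = 1 / real K" using K by (simp add: exp_minus divide_inverse)
  finally show ?thesis .
qed

lemma variation_le:
  fixes z :: "nat \<Rightarrow> real"
  assumes "\<And>n. (\<Sum>i = a + 1..a + n. \<bar>z i - z (i - 1)\<bar>) \<le> \<eta>" and "a \<le> m"
  shows "(\<Sum>i = Suc m..<n. \<bar>z i - z (i - 1)\<bar>) \<le> \<eta>"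
proof -
  have "(\<Sum>i = Suc m..<n. \<bar>z i - z (i - 1)\<bar>) \<le> (\<Sum>i = a + 1..a + n. \<bar>z i - z (i - 1)\<bar>)"
    using assms(2) by (intro sum_mono2) auto
  with assms(1) show ?thesis using order_trans by blast
qed

text \<open>Unroll \<open>displacement_step\<close> with \<open>c = 0\<close>. In units of
  \<open>1 / (k + 1)\<close>, the initial displacement contributes 1/3, the variation of
  \<open>\<beta>\<close> 1/6 and that of \<open>lam\<close> 1/15.\<close>

lemma displacement_rate:
  assumes n: "nu1 k \<le> n"
  shows "norm (x (Suc n) - x n) \<le> 1 / (real k + 1)"
proof -
  define \<kappa> where "\<kappa> = real k + 1"
  have pos: "0 < \<kappa>" "0 < real N" using N_pos by (auto simp: \<kappa>_def)
  define m where "m = rate_G N B L (3 * k + 2)"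
  \<comment> \<open>The shift aligns \<open>s\<close> with the differences in \<open>B_rate\<close>
    and \<open>L_rate\<close>; the recursion starts at \<open>Suc m\<close>, so \<open>i - 1\<close>
    does not truncate there.\<close>
  define s where "s i = norm (x i - x (i - 1))" for i
  define e where "e i = 2 * real N * \<bar>\<beta> i - \<beta> (i - 1)\<bar> + 2 * real N * \<bar>lam i - lam (i - 1)\<bar>" for i
  define K where "K = 6 * N * (k + 1)"
  have D: "D (m + nat \<lceil>ln (real K)\<rceil>) + 1 \<le> Suc n"
    using n unfolding rate_nu1_def Let_def m_def K_def by simp
  moreover note le_D[of "m + nat \<lceil>ln (real K)\<rceil>"]
  ultimately have m: "Suc m \<le> Suc n" by linarith
  have "s (Suc n) \<le> (\<Prod>i=Suc m..<Suc n. \<beta> i) * s (Suc m) + 0 + (\<Sum>i=Suc m..<Suc n. e i)"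
  proof (rule recursive_inequality_bound)
    fix i assume "Suc m \<le> i"
    then show "s (Suc i) \<le> \<beta> i * s i + (1 - \<beta> i) * 0 + e i"
      using displacement_step[of "i - 1"] by (cases i) (auto simp: s_def e_def)
  qed (use m \<beta>_pos \<beta>_le in \<open>auto simp: e_def less_imp_le\<close>)
  also have "(\<Prod>i=Suc m..<Suc n. \<beta> i) * s (Suc m) \<le> 1 / real K * (2 * real N)"
  proof (intro mult_mono prod_\<beta>_le D)
    show "s (Suc m) \<le> 2 * real N"
      using norm_triangle_ineq4[of "x (Suc m) - p" "x m - p"] x_ball[of m] x_ball[of "Suc m"]
      by (simp add: s_def)
  qed (use N_pos in \<open>auto simp: K_def s_def\<close>)
  also have "real K = 6 * real N * \<kappa>" by (simp add: K_def \<kappa>_def algebra_simps)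
  also have "1 / (6 * real N * \<kappa>) * (2 * real N) = 1 / 3 / \<kappa>" using pos by simp
  also have "(\<Sum>i=Suc m..<Suc n. e i) = 2 * real N * (\<Sum>i=Suc m..<Suc n. \<bar>\<beta> i - \<beta> (i - 1)\<bar>)
      + 2 * real N * (\<Sum>i=Suc m..<Suc n. \<bar>lam i - lam (i - 1)\<bar>)"
    unfolding e_def sum.distrib sum_distrib_left ..
  also have "\<dots> \<le> 2 * real N * (1 / (12 * real N * \<kappa>)) + 2 * real N * (1 / (30 * real N * \<kappa>))"
  proof (intro add_mono mult_left_mono)
    have "real (4 * N * (3 * k + 2 + 1) - 1) + 1 = 12 * real N * \<kappa>"
      using N_pos by (subst of_nat_diff) (auto simp: \<kappa>_def algebra_simps Suc_le_eq)
    with B_rate[of "4 * N * (3 * k + 2 + 1) - 1"]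
    show "(\<Sum>i=Suc m..<Suc n. \<bar>\<beta> i - \<beta> (i - 1)\<bar>) \<le> 1 / (12 * real N * \<kappa>)"
      by (intro variation_le[where a = "B (4 * N * (3 * k + 2 + 1) - 1)"]) (auto simp: m_def rate_G_def)
    have "real (10 * N * (3 * k + 2 + 1) - 1) + 1 = 30 * real N * \<kappa>"
      using N_pos by (subst of_nat_diff) (auto simp: \<kappa>_def algebra_simps Suc_le_eq)
    with L_rate[of "10 * N * (3 * k + 2 + 1) - 1"]
    show "(\<Sum>i=Suc m..<Suc n. \<bar>lam i - lam (i - 1)\<bar>) \<le> 1 / (30 * real N * \<kappa>)"
      by (intro variation_le[where a = "L (10 * N * (3 * k + 2 + 1) - 1)"]) (auto simp: m_def rate_G_def)
  qed auto
  also have "1 / 3 / \<kappa> + 0 + (2 * real N * (1 / (12 * real N * \<kappa>))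
      + 2 * real N * (1 / (30 * real N * \<kappa>))) = (17 / 30) / \<kappa>"
    using pos by (simp add: field_simps)
  also have "\<dots> \<le> 1 / \<kappa>" using pos by (intro divide_right_mono) auto
  finally show ?thesis by (simp add: s_def \<kappa>_def)
qed

text \<open>The vector \<open>lam n *\<^sub>R (T (y n) - y n)\<close> is the displacement of
  \<open>x\<close> plus \<open>(1 - \<beta> n) *\<^sub>R x n\<close>; each part is at most
  \<open>1 / (2 l (k + 1))\<close>, and \<open>lam_ge\<close> removes the factor.\<close>

lemma approx_fixpoint_rate:
  assumes n: "nu2 k \<le> n"
  shows "norm (T (y n) - y n) \<le> 1 / (real k + 1)"
proof -
  define \<kappa> where "\<kappa> = real k + 1"
  have pos: "0 < \<kappa>" "0 < real N" "0 < real l" using N_pos l_pos by (auto simp: \<kappa>_def)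
  have nu1: "nu1 (2 * l * (k + 1) - 1) \<le> n" and b: "b (4 * N * l * (k + 1) - 1) \<le> n"
    using n by (auto simp: rate_nu2_def)
  have "real (2 * l * (k + 1) - 1) + 1 = 2 * real l * \<kappa>"
    using l_pos by (subst of_nat_diff) (auto simp: \<kappa>_def algebra_simps Suc_le_eq)
  with displacement_rate[OF nu1] have 1: "norm (x (Suc n) - x n) \<le> 1 / (2 * real l * \<kappa>)" by simp
  have "real (4 * N * l * (k + 1) - 1) + 1 = 4 * real N * real l * \<kappa>"
    using N_pos l_pos by (subst of_nat_diff) (auto simp: \<kappa>_def algebra_simps Suc_le_eq)
  with b_rate[OF b] have 2: "1 - \<beta> n \<le> 1 / (4 * real N * real l * \<kappa>)" by simp
  have "(1 / real l) * norm (T (y n) - y n) \<le> lam n * norm (T (y n) - y n)"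
    using lam_ge by (intro mult_right_mono) auto
  also have "\<dots> = norm (lam n *\<^sub>R (T (y n) - y n))" using lam_pos[of n] by simp
  also have "lam n *\<^sub>R (T (y n) - y n) = (x (Suc n) - x n) + (1 - \<beta> n) *\<^sub>R x n"
    unfolding x_Suc by (simp add: y_def algebra_simps)
  also have "norm \<dots> \<le> norm (x (Suc n) - x n) + (1 - \<beta> n) * norm (x n)"
    using norm_triangle_ineq[of "x (Suc n) - x n" "(1 - \<beta> n) *\<^sub>R x n"] \<beta>_le[of n] by simp
  also have "\<dots> \<le> 1 / (2 * real l * \<kappa>) + 1 / (4 * real N * real l * \<kappa>) * (2 * real N)"
    using 1 2 norm_x \<beta>_le pos by (intro add_mono mult_mono) auto
  also have "\<dots> = (1 / real l) * (1 / \<kappa>)" using pos by (simp add: field_simps)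
  finally have "norm (T (y n) - y n) \<le> 1 / \<kappa>" using pos by (simp add: divide_right_mono field_simps)
  then show ?thesis by (simp add: \<kappa>_def)
qed

section \<open>Approximate projection along the iterates and metastability\<close>

lemma mono_nu1: "mono nu1"
proof (rule monoI)
  fix i j :: nat assume "i \<le> j"
  then have "rate_G N B L (3 * i + 2) \<le> rate_G N B L (3 * j + 2)"
    unfolding rate_G_def
    by (intro max.mono monoD[OF mono_B] monoD[OF mono_L] diff_le_mono mult_le_mono) auto
  moreover have "ln (real (6 * N * (i + 1))) \<le> ln (real (6 * N * (j + 1)))"
    using \<open>i \<le> j\<close> N_pos by (subst ln_le_cancel_iff) (simp_all only: of_nat_0_less_iff of_nat_le_iff, auto)
  ultimately show "nu1 i \<le> nu1 j"
    unfolding rate_nu1_def Let_def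
    by (intro add_right_mono monoD[OF mono_D] add_mono nat_mono ceiling_mono) auto
qed

lemma mono_nu2: "mono nu2"
  unfolding rate_nu2_def
  by (intro monoI max.mono monoD[OF mono_b] monoD[OF mono_nu1] diff_le_mono mult_le_mono) auto

text \<open>From stage \<open>n\<^sub>0\<close> on, all \<open>y n\<close> are accurate enough to
  compete in \<open>approx_projection\<close>, while \<open>\<rho>\<close> makes \<open>w\<close> as
  accurate as \<open>f n\<^sub>0\<close> demands. The round \<open>i\<close> is unknown;
  monotonicity of \<open>nu2\<close> replaces it by \<open>R\<close>.\<close>

lemma approx_projection_of_iterates:
  obtains n\<^sub>0 w where "n\<^sub>0 \<le> rate_psi N l b D B L k f" and "norm (w - p) \<le> real N"
    and "norm (T w - w) \<le> 1 / (real (f n\<^sub>0) + 1)"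
    and "\<And>n. n\<^sub>0 \<le> n \<Longrightarrow> w \<bullet> (w - y n) \<le> 1 / (real k + 1)"
proof -
  define \<rho> where "\<rho> m = max (f (nu2 (48 * N * (m + 1)\<^sup>2))) (48 * N * (m + 1)\<^sup>2)" for m
  define R where "R = 64 * N ^ 4 * (k + 1)\<^sup>2"
  have "4 * (N ^ 4 * (k + 1)\<^sup>2) < 64 * (N ^ 4 * (k + 1)\<^sup>2)"
    using N_pos by (intro mult_strict_right_mono) auto
  then have R: "4 * N ^ 4 * (k + 1)\<^sup>2 < R" by (simp add: R_def mult.assoc)
  obtain i w where i: "i < R" and w: "norm (w - p) \<le> real N"
    "norm (T w - w) \<le> 1 / (real ((\<rho> ^^ Suc i) 0) + 1)"
    and proj: "\<And>q. norm (q - p) \<le> real N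
      \<Longrightarrow> norm (T q - q) \<le> 1 / (real (48 * N * ((\<rho> ^^ i) 0 + 1)\<^sup>2) + 1)
      \<Longrightarrow> w \<bullet> (w - q) \<le> 1 / (real k + 1)"
    using approx_projection[OF nonexp fix_p norm_p N_pos _ R, of \<rho>] by (auto simp: \<rho>_def)
  define m where "m = (\<rho> ^^ i) 0"
  define n\<^sub>0 where "n\<^sub>0 = nu2 (48 * N * (m + 1)\<^sup>2)"
  have "m' \<le> \<rho> m'" for m'
  proof -
    have "m' * 1 \<le> (m' + 1) * (m' + 1)" by (intro mult_le_mono) auto
    also have "\<dots> \<le> 48 * N * (m' + 1)\<^sup>2"
      using N_pos mult_le_mono1[of 1 "48 * N" "(m' + 1)\<^sup>2"] by (simp add: power2_eq_square)
    finally show ?thesis by (simp add: \<rho>_def)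
  qed
  note \<rho>_ge = this
  have "(\<rho> ^^ i) 0 \<le> (\<rho> ^^ R) 0" if "i \<le> R" for R
    using that
  proof (induction R rule: dec_induct)
    case (step R)
    then show ?case using \<rho>_ge[of "(\<rho> ^^ R) 0"] by simp
  qed simp
  then have "m \<le> (\<rho> ^^ R) 0" using i by (simp add: m_def)
  then have "n\<^sub>0 \<le> nu2 (48 * N * ((\<rho> ^^ R) 0 + 1)\<^sup>2)"
    unfolding n\<^sub>0_def by (intro monoD[OF mono_nu2] mult_le_mono power_mono) auto
  then have "n\<^sub>0 \<le> rate_psi N l b D B L k f"
    unfolding rate_psi_def Let_def \<rho>_def R_def .
  moreover have "norm (T w - w) \<le> 1 / (real (f n\<^sub>0) + 1)"
  proof -
    have "f n\<^sub>0 \<le> (\<rho> ^^ Suc i) 0" by (simp add: n\<^sub>0_def m_def \<rho>_def)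
    then have "1 / (real ((\<rho> ^^ Suc i) 0) + 1) \<le> 1 / (real (f n\<^sub>0) + 1)"
      by (intro divide_left_mono) auto
    with w(2) show ?thesis by linarith
  qed
  moreover have "w \<bullet> (w - y n) \<le> 1 / (real k + 1)" if "n\<^sub>0 \<le> n" for n
    using that approx_fixpoint_rate y_ball unfolding n\<^sub>0_def m_def by (intro proj) blast+
  ultimately show ?thesis using that w(1) by blast
qed

text \<open>The relaxed map moves \<open>w\<close> by at most \<open>\<epsilon>\<close>, which after
  squaring costs \<open>(4 N + 1) \<epsilon>\<close>. The rest expands \<open>\<beta> n *\<^sub>R (x
  n - w) = (y n - w) + (1 - \<beta> n) *\<^sub>R w\<close> and drops a square.\<close>

lemma dist_sq_step:
  assumes w: "norm (w - p) \<le> real N" and \<epsilon>: "norm (T w - w) \<le> \<epsilon>" "\<epsilon> \<le> 1"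
    and c: "2 * (w \<bullet> (w - y n)) \<le> c"
  shows "(norm (x (Suc n) - w))\<^sup>2
    \<le> \<beta> n * (norm (x n - w))\<^sup>2 + (1 - \<beta> n) * c + (4 * real N + 1) * \<epsilon>"
proof -
  have "0 \<le> \<epsilon>" using \<epsilon> norm_ge_zero order_trans by blast
  have yw: "norm (y n - w) \<le> 2 * real N"
    using norm_triangle_ineq4[of "y n - p" "w - p"] w y_ball[of n] by simp
  have "x (Suc n) - w = (((1 - lam n) *\<^sub>R y n + lam n *\<^sub>R T (y n))
      - ((1 - lam n) *\<^sub>R w + lam n *\<^sub>R T w)) + lam n *\<^sub>R (T w - w)"
    unfolding x_Suc by (simp add: algebra_simps)
  also have "norm \<dots> \<le> norm (y n - w) + norm (lam n *\<^sub>R (T w - w))"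
    by (intro order_trans[OF norm_triangle_ineq] add_right_mono relaxed_nonexp)
  also have "norm (lam n *\<^sub>R (T w - w)) = \<bar>lam n\<bar> * norm (T w - w)" by simp
  also have "\<bar>lam n\<bar> * norm (T w - w) \<le> 1 * \<epsilon>"
    using \<epsilon> lam_pos[of n] lam_le[of n] by (intro mult_mono) auto
  finally have "(norm (x (Suc n) - w))\<^sup>2 \<le> (norm (y n - w) + 1 * \<epsilon>)\<^sup>2"
    by (intro power_mono) auto
  also have "\<dots> = (norm (y n - w))\<^sup>2 + (2 * norm (y n - w) + \<epsilon>) * \<epsilon>"
    by (simp add: power2_eq_square algebra_simps)
  also have "(2 * norm (y n - w) + \<epsilon>) * \<epsilon> \<le> (4 * real N + 1) * \<epsilon>"
    using yw \<epsilon> \<open>0 \<le> \<epsilon>\<close> by (intro mult_right_mono) auto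
  also have "(norm (y n - w))\<^sup>2 \<le> \<beta> n * (norm (x n - w))\<^sup>2 + (1 - \<beta> n) * c"
  proof -
    have "y n - w = \<beta> n *\<^sub>R (x n - w) - (1 - \<beta> n) *\<^sub>R w" by (simp add: y_def algebra_simps)
    then have eq: "\<beta> n *\<^sub>R (x n - w) = (y n - w) + (1 - \<beta> n) *\<^sub>R w" by simp
    have "(norm (\<beta> n *\<^sub>R (x n - w)))\<^sup>2
        = (norm (y n - w))\<^sup>2 - 2 * (1 - \<beta> n) * (w \<bullet> (w - y n)) + (norm ((1 - \<beta> n) *\<^sub>R w))\<^sup>2"
      unfolding eq power2_norm_eq_inner
      by (simp add: inner_add_left inner_add_right inner_diff_left inner_diff_right
          inner_commute algebra_simps)
    then have "(norm (y n - w))\<^sup>2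
        \<le> (norm (\<beta> n *\<^sub>R (x n - w)))\<^sup>2 + (1 - \<beta> n) * (2 * (w \<bullet> (w - y n)))"
      using zero_le_power2[of "norm ((1 - \<beta> n) *\<^sub>R w)"] by (simp add: algebra_simps)
    also have "(norm (\<beta> n *\<^sub>R (x n - w)))\<^sup>2 = (\<beta> n * \<beta> n) * (norm (x n - w))\<^sup>2"
      using \<beta>_pos[of n] by (simp add: power_mult_distrib power2_eq_square)
    also have "\<dots> \<le> (\<beta> n * 1) * (norm (x n - w))\<^sup>2"
      using \<beta>_pos[of n] \<beta>_le[of n] by (intro mult_right_mono mult_left_mono) auto
    also have "(1 - \<beta> n) * (2 * (w \<bullet> (w - y n))) \<le> (1 - \<beta> n) * c"
      using c \<beta>_le[of n] by (intro mult_left_mono) auto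
    finally show ?thesis by simp
  qed
  finally show ?thesis by simp
qed

theorem metastability:
  assumes h: "\<And>n. 0 < h n"
  shows "\<exists>n \<le> rate_mu N l b h D B L k f.
    \<forall>i \<in> {n..f n}. \<forall>j \<in> {n..f n}. norm (x i - x j) \<le> 1 / (real k + 1)"
proof -
  define kt where "kt = 4 * (k + 1)\<^sup>2 - 1"
  define n1 where "n1 = b (54 * N\<^sup>2 * (kt + 1) - 1)"
  define fb where "fb m = f (rate_sigma N D kt (max m n1))" for m
  define ft where "ft m = 3 * (10 * N + 1) * (kt + 1) * (fb m + 1) * h (fb m) - 1" for m
  have kt_Suc: "kt + 1 = 4 * (k + 1)\<^sup>2" by (simp add: kt_def)
  define \<kappa> where "\<kappa> = real kt + 1"
  have \<kappa>: "0 < \<kappa>" "\<kappa> = 4 * (real k + 1)\<^sup>2"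
    using kt_Suc[THEN arg_cong, of real] by (auto simp: \<kappa>_def add.commute)
  have Npos: "1 \<le> real N" using N_pos by simp
  obtain n0 w where n0: "n0 \<le> rate_psi N l b D B L (12 * (kt + 1) - 1) ft"
    and w: "norm (w - p) \<le> real N" "norm (T w - w) \<le> 1 / (real (ft n0) + 1)"
    and proj: "\<And>n. n0 \<le> n \<Longrightarrow> w \<bullet> (w - y n) \<le> 1 / (real (12 * (kt + 1) - 1) + 1)"
    using approx_projection_of_iterates by blast
  define m where "m = max n0 n1"
  define n where "n = rate_sigma N D kt m"
  have fb: "fb n0 = f n" by (simp add: fb_def n_def m_def)
  \<comment> \<open>Up to stage \<open>f n\<close> the recursion takes at most
    \<open>f n + 1\<close> steps, so the accumulated error stays below
    \<open>1 / (3 \<kappa>)\<close>.\<close>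
  define \<epsilon> where "\<epsilon> = 1 / (3 * (10 * real N + 1) * \<kappa> * (real (f n) + 1))"
  have ft: "3 * (10 * real N + 1) * \<kappa> * (real (f n) + 1) \<le> real (ft n0) + 1"
  proof -
    have "3 * (10 * N + 1) * (kt + 1) * (f n + 1) * 1
        \<le> 3 * (10 * N + 1) * (kt + 1) * (f n + 1) * h (f n)"
      using h[of "f n"] by (intro mult_le_mono2) simp
    then have "3 * (10 * N + 1) * (kt + 1) * (f n + 1) \<le> ft n0 + 1"
      unfolding ft_def fb by simp
    then have "real (3 * (10 * N + 1) * (kt + 1) * (f n + 1)) \<le> real (ft n0 + 1)"
      by (rule of_nat_mono)
    then show ?thesis by (simp add: \<kappa>_def algebra_simps)
  qed
  have "1 \<le> 3 * (10 * real N + 1) * \<kappa> * (real (f n) + 1)"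
    using Npos by (intro mult_ge1_I) (auto simp: \<kappa>_def)
  then have \<epsilon>: "norm (T w - w) \<le> \<epsilon>" "0 \<le> \<epsilon>" "\<epsilon> \<le> 1"
    using w(2) ft unfolding \<epsilon>_def
    by (auto intro!: order_trans[OF w(2)] divide_left_mono)
  have sq_le: "(norm (x i - w))\<^sup>2 \<le> 1 / \<kappa>" if i: "n \<le> i" "i \<le> f n" for i
  proof -
    define K where "K = 27 * N\<^sup>2 * (kt + 1)"
    have D: "D (m + nat \<lceil>ln (real K)\<rceil>) + 1 \<le> i"
      using i(1) unfolding n_def rate_sigma_def K_def .
    with le_D[of "m + nat \<lceil>ln (real K)\<rceil>"] have m: "Suc m \<le> i" by linarith
    have "(norm (x i - w))\<^sup>2 \<le> (\<Prod>j=Suc m..<i. \<beta> j) * (norm (x (Suc m) - w))\<^sup>2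
        + 1 / (6 * \<kappa>) + (\<Sum>j=Suc m..<i. (4 * real N + 1) * \<epsilon>)"
    \<comment> \<open>In units of \<open>1 / \<kappa>\<close> the budget is 4/27 for the initial
      value, 1/6 for \<open>c\<close> and 1/3 for the errors.\<close>
    proof (rule recursive_inequality_bound[where s = "\<lambda>j. (norm (x j - w))\<^sup>2"])
      fix j assume "Suc m \<le> j"
      then have "w \<bullet> (w - y j) \<le> 1 / (real (12 * (kt + 1) - 1) + 1)"
        by (intro proj) (simp add: m_def)
      also have "\<dots> = 1 / (12 * \<kappa>)" by (simp add: \<kappa>_def)
      finally show "(norm (x (Suc j) - w))\<^sup>2 \<le> \<beta> j * (norm (x j - w))\<^sup>2
          + (1 - \<beta> j) * (1 / (6 * \<kappa>)) + (4 * real N + 1) * \<epsilon>"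
        using w(1) \<epsilon> by (intro dist_sq_step) auto
    qed (use m \<beta>_pos \<beta>_le \<epsilon> \<kappa> in \<open>auto simp: less_imp_le\<close>)
    also have "(\<Prod>j=Suc m..<i. \<beta> j) * (norm (x (Suc m) - w))\<^sup>2 \<le> 1 / real K * (2 * real N)\<^sup>2"
    proof (intro mult_mono prod_\<beta>_le D power_mono)
      show "norm (x (Suc m) - w) \<le> 2 * real N"
        using norm_triangle_ineq4[of "x (Suc m) - p" "w - p"] x_ball[of "Suc m"] w(1) by simp
    qed (use N_pos in \<open>auto simp: K_def\<close>)
    also have "real K = 27 * (real N)\<^sup>2 * \<kappa>" by (simp add: K_def \<kappa>_def algebra_simps)
    also have "1 / (27 * (real N)\<^sup>2 * \<kappa>) * (2 * real N)\<^sup>2 = 4 / 27 / \<kappa>"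
      using Npos by (simp add: power_mult_distrib)
    also have "(\<Sum>j=Suc m..<i. (4 * real N + 1) * \<epsilon>) = real (i - Suc m) * ((4 * real N + 1) * \<epsilon>)"
      by simp
    also have "\<dots> \<le> (real (f n) + 1) * ((10 * real N + 1) * \<epsilon>)"
      using i(2) \<epsilon> by (intro mult_mono) auto
    also have "\<dots> = 1 / 3 / \<kappa>"
    proof -
      have "10 * real N + 1 \<noteq> 0" "real (f n) + 1 \<noteq> 0" using Npos by linarith+
      moreover have "u * (v * (1 / (3 * v * \<kappa> * u))) = 1 / 3 / \<kappa>" if "v \<noteq> 0" "u \<noteq> 0" for u v
        using that by simp
      ultimately show ?thesis unfolding \<epsilon>_def by blast
    qed
    also have "4 / 27 / \<kappa> + 1 / (6 * \<kappa>) + 1 / 3 / \<kappa> = (35 / 54) / \<kappa>"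
      using \<kappa>(1) by (simp add: field_simps)
    also have "\<dots> \<le> 1 / \<kappa>" using \<kappa>(1) by (intro divide_right_mono) auto
    finally show ?thesis by simp
  qed
  have dist_le: "norm (x i - w) \<le> 1 / (2 * (real k + 1))" if "n \<le> i" "i \<le> f n" for i
  proof (rule power2_le_imp_le)
    \<comment> \<open>The choice of \<open>kt\<close> absorbs both the square and the factor 2 of
      the final triangle inequality.\<close>
    have "1 / \<kappa> = (1 / (2 * (real k + 1)))\<^sup>2" 
      unfolding \<kappa>(2) power_divide power_mult_distrib by simp
    with sq_le[OF that] show "(norm (x i - w))\<^sup>2 \<le> (1 / (2 * (real k + 1)))\<^sup>2" by simp
  qed simp
  have "norm (x i - x j) \<le> 1 / (real k + 1)" if "i \<in> {n..f n}" "j \<in> {n..f n}" for i j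
  proof -
    have "norm (x i - x j) \<le> 1 / (2 * (real k + 1)) + 1 / (2 * (real k + 1))"
      using norm_triangle_ineq4[of "x i - w" "x j - w"] dist_le[of i] dist_le[of j] that by simp
    then show ?thesis by (simp add: field_simps)
  qed
  moreover have "n \<le> rate_mu N l b h D B L k f"
  proof -
    have "n \<le> rate_sigma N D kt (max (rate_psi N l b D B L (12 * (kt + 1) - 1) ft) n1)"
      unfolding n_def m_def rate_sigma_def
      using n0 by (intro add_right_mono monoD[OF mono_D]) auto
    then show ?thesis unfolding rate_mu_def Let_def kt_def n1_def fb_def ft_def .
  qed
  ultimately show ?thesis by blast
qed

end


section \<open>The forward-backward iteration\<close>

theorem corollary3p8:
  fixes T1 :: "'a::{real_inner, complete_space} \<Rightarrow> 'a set"
    and T2 :: "'a \<Rightarrow> 'a"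
    and \<delta> \<gamma> :: real
    and \<beta> lam :: "nat \<Rightarrow> real"
    and x0 :: 'a and x :: "nat \<Rightarrow> 'a"
    and l N :: nat
    and b D B L h :: "nat \<Rightarrow> nat"
  assumes "maximal_monotone_op T1"
    and "\<delta> > 0" and "cocoercive \<delta> T2"
    and "\<gamma> \<in> {0<..2 * \<delta>}"
    and "\<And>n. \<beta> n \<in> {0<..1}"
    and "\<And>n. lam n \<in> {0<..(4 * \<delta> - \<gamma>) / (2 * \<delta>)}"
    and "x 0 = x0"
    and "\<And>n. x (Suc n) = ((1 - lam n) * \<beta> n) *\<^sub>R x n
           + lam n *\<^sub>R resolvent \<gamma> T1 (\<beta> n *\<^sub>R x n - \<gamma> *\<^sub>R T2 (\<beta> n *\<^sub>R x n))"
    and "l > 0"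
    and "mono b" and "mono D" and "mono B" and "mono L"
    and "mono h" and "\<And>n. h n > 0"
    and "\<And>n. \<beta> n \<ge> 1 / real (h n)"
    and "\<And>k n. n \<ge> b k \<Longrightarrow> \<bar>1 - \<beta> n\<bar> \<le> 1 / (real k + 1)"
    and "\<And>k. (\<Sum>i = 1..D k. 1 - \<beta> i) \<ge> real k"
    and "\<And>k n. (\<Sum>i = B k + 1..B k + n. \<bar>\<beta> i - \<beta> (i - 1)\<bar>) \<le> 1 / (real k + 1)"
    and "\<And>n. lam n \<ge> 1 / real l"
    and "\<And>k n. (\<Sum>i = L k + 1..L k + n. \<bar>lam i - lam (i - 1)\<bar>) \<le> 1 / (real k + 1)"
    and "N > 0"
    and "\<exists>p \<in> zer (op_sum T1 (\<lambda>y. {T2 y})). real N \<ge> max (norm (x0 - p)) (norm p)"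
  shows "\<forall>k. \<forall>f :: nat \<Rightarrow> nat. mono f \<longrightarrow>
           (\<exists>n \<le> rate_mu N (2 * l) b h D B L k f.
              \<forall>i \<in> {n..f n}. \<forall>j \<in> {n..f n}. norm (x i - x j) \<le> 1 / (real k + 1))"
proof -
  define \<alpha> where "\<alpha> = 2 * \<delta> / (4 * \<delta> - \<gamma>)"
  define FB where "FB = (\<lambda>u. resolvent \<gamma> T1 (u - \<gamma> *\<^sub>R T2 u))"
  define T where "T = (\<lambda>u. (1 / \<alpha>) *\<^sub>R (FB u - (1 - \<alpha>) *\<^sub>R u))"
  have \<gamma>: "0 < \<gamma>" "\<gamma> \<le> 2 * \<delta>" using assms(4) by auto
  have \<alpha>: "0 < \<alpha>" "1 / 2 \<le> \<alpha>" "\<alpha> \<le> 1" using \<gamma> by (auto simp: \<alpha>_def field_simps)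
  have lam: "0 < lam n" "lam n \<le> 1 / \<alpha>" for n
    using assms(6)[of n] by (auto simp: \<alpha>_def)
  have \<beta>: "0 < \<beta> n" "\<beta> n \<le> 1" for n using assms(5)[of n] by auto
  have FB_eq: "FB u = (1 - \<alpha>) *\<^sub>R u + \<alpha> *\<^sub>R T u" for u using \<alpha> by (simp add: T_def)
  obtain p where p: "p \<in> zer (op_sum T1 (\<lambda>y. {T2 y}))" "norm (x 0 - p) \<le> real N" "norm p \<le> real N"
    using assms(23) assms(7) by auto
  \<comment> \<open>A zero \<open>p\<close> has \<open>- T2 p\<close> in \<open>T1 p\<close>, so the
    resolvent sends \<open>p - \<gamma> *\<^sub>R T2 p\<close> back to \<open>p\<close>.\<close>
  have "FB p = p"
  proof -
    obtain u where u: "u \<in> T1 p" "0 = u + T2 p" using p(1) by (auto simp: zer_def op_sum_def)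
    then have "T2 p = - u" by (metis add.commute minus_unique)
    then show ?thesis
      unfolding FB_def using assms(1) \<gamma>(1) u(1)
      by (intro resolvent_eqI[of _ _ u]) (auto simp: maximal_monotone_op_def)
  qed
  interpret regularised_iteration T p x \<beta> "\<lambda>n. \<alpha> * lam n" N "2 * l" b D B L
  proof
    fix u v n k
    have "norm (T u - T v) = norm ((1 / \<alpha>) *\<^sub>R (FB u - FB v - (1 - \<alpha>) *\<^sub>R (u - v)))"
      by (rule arg_cong[where f = norm]) (simp add: T_def algebra_simps)
    also have "\<dots> \<le> 1 / \<alpha> * (\<alpha> * norm (u - v))"
      using \<alpha> forward_backward_averaged[OF assms(1,3) \<gamma>, of u v]
      unfolding norm_scaleR FB_def \<alpha>_def[symmetric] by (intro mult_mono) auto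
    finally show "norm (T u - T v) \<le> norm (u - v)" using \<alpha> by simp
    show "T p = p" using \<alpha> \<open>FB p = p\<close> by (simp add: T_def algebra_simps)
    show "0 < \<alpha> * lam n" using \<alpha> lam by simp
    show "\<alpha> * lam n \<le> 1" using \<alpha> lam(2)[of n] by (simp add: field_simps)
    \<comment> \<open>This is where \<open>2 * l\<close> replaces \<open>l\<close>.\<close>
    have "1 / 2 * (1 / real l) \<le> \<alpha> * lam n" using \<alpha> assms(20) by (intro mult_mono) auto
    then show "1 / real (2 * l) \<le> \<alpha> * lam n" by simp
    have "x (Suc n) = (1 - lam n) *\<^sub>R (\<beta> n *\<^sub>R x n) + lam n *\<^sub>R FB (\<beta> n *\<^sub>R x n)"
      using assms(8)[of n] by (simp add: FB_def)
    then show "x (Suc n) = (1 - \<alpha> * lam n) *\<^sub>R (\<beta> n *\<^sub>R x n) + (\<alpha> * lam n) *\<^sub>R T (\<beta> n *\<^sub>R x n)"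
      unfolding FB_eq by (simp add: algebra_simps)
    show "1 - \<beta> n \<le> 1 / (real k + 1)" if "b k \<le> n" using assms(17)[OF that] by simp
    \<comment> \<open>Since \<open>\<alpha> \<le> 1\<close>, the rate \<open>L\<close> also serves
      the rescaled relaxations.\<close>
    have "(\<Sum>i = L k + 1..L k + n. \<bar>\<alpha> * lam i - \<alpha> * lam (i - 1)\<bar>)
        = \<alpha> * (\<Sum>i = L k + 1..L k + n. \<bar>lam i - lam (i - 1)\<bar>)"
      using \<alpha> by (simp add: sum_distrib_left abs_mult flip: right_diff_distrib)
    also have "\<dots> \<le> 1 * (1 / (real k + 1))"
      using \<alpha> assms(21) by (intro mult_mono sum_nonneg) auto
    finally show "(\<Sum>i = L k + 1..L k + n. \<bar>\<alpha> * lam i - \<alpha> * lam (i - 1)\<bar>) \<le> 1 / (real k + 1)"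
      by simp
  qed (use p \<beta> assms(9-13,18,19,22) in auto)
  show ?thesis using metastability[of h, OF assms(15)] by blast
qed

end
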